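(* Let $\mu$ be a probability measure on $\{0,1\}^\infty$ with $\mu \neq B(1/2,1/2)$. (i) With $\mu$-probability $1$, for $x = x_1x_2\ldots \in \{0,1\}^\infty$, $$\limsup_{n\to\infty} \frac{-\log \pi_\mu(x|_1^n)}{n} \;\ge\; 1-\delta_\mu(x),$$ where $\pi_\mu(x|_1^n)$ is the p-value of the word $x|_1^n$ for the statistic $\tau(w)=\mu(w)$. (ii) Let $M$ be a universal enumerable (lower semicomputable) semimeasure and suppose that $\mu$ is computable. Then, with $\mu$-probability $1$, for $x = x_1x_2\ldots\in\{0,1\}^\infty$, $$\limsup_{n\to\infty} \frac{-\log \pi_M(x|_1^n)}{n} \;\ge\; 1-\delta_\mu(x),$$ where $\pi_M(x|_1^n)$ is the p-value of the word $x|_1^n$ for the statistic $\tau(w)=M(w)$.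
   Context: Logarithms are to base 2. $\{0,1\}^n$ is the set of binary words of length $n$, $\{0,1\}^*$ the set of finite binary words, and $\{0,1\}^\infty$ the set of one-sided infinite binary sequences. For $x=x_1x_2\ldots\in\{0,1\}^\infty$, $x|_1^n = x_1\ldots x_n$. $B(1/2,1/2)$ is the Bernoulli (fair coin) measure on $\{0,1\}^\infty$. For a measure $\mu$ on $\{0,1\}^\infty$ and a finite word $w$, $\mu(w)$ denotes the $\mu$-measure of the set of infinite sequences beginning with $w$. p-value: for a statistic $\tau$, i.e. a real-valued function on binary words of length $n$, and $w\in\{0,1\}^n$, $$\pi_\tau(w) = |\{y\in\{0,1\}^n : \tau(y)\ge \tau(w)\}|/2^n.$$ $\pi_\mu$ and $\pi_M$ denote the p-values for the statistics $w\mapsto\mu(w)$ and $w\mapsto M(w)$ respectively. Lower pointwise dimension of $\mu$ at $x$: $$\delta_\mu(x)=\liminf_{n\to\infty} \frac{-1}{n}\log\mu\big([0.x_1\ldots x_n,\;0.x_1\ldots x_n+2^{-n})\big),$$ where $0.x_1\ldots x_n$ is the real number in $[0,1)$ with this binary expansion and the dyadic interval is identified with the cylinder set of all infinite sequences beginning with $x_1\ldots x_n$, so that the measure appearing in the formula is $\mu(x_1\ldots x_n)$. A semimeasure is a function $M:\{0,1\}^*\to[0,1]$ such that $M(\text{empty word})\le 1$ and $M(u)\ge M(u0)+M(u1)$ for all words $u$. It is enumerable (lower semicomputable) if it is the pointwise limit of a computable nondecreasing sequence of rational-valued functions. An enumerable semimeasure $M$ is universal if for every enumerable semimeasure $\rho$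 there is a constant $c>0$ with $M(u)\ge c\,\rho(u)$ for all words $u$; in particular, for every computable measure $\mu$ there is a constant $C$ with $-\log M(u)\le -\log\mu(u)+C$ for all $u$. *)

theory Defs
  imports "HOL-Probability.Probability" "HOL-Library.Nat_Bijection"
begin

definition fair_coin :: "bool stream measure" where
  "fair_coin = stream_space (measure_pmf (bernoulli_pmf (1/2)))"

definition cyl :: "bool stream measure \<Rightarrow> bool list \<Rightarrow> real" where
  "cyl \<mu> w = measure \<mu> {x \<in> space \<mu>. stake (length w) x = w}"

text \<open>Since \<open>log 2 0 = 0\<close> in the library, the convention that \<open>- log 0\<close> is infinite is made explicit.\<close>

definition neg_log2 :: "real \<Rightarrow> ereal" where
  "neg_log2 p = (if p = 0 then \<infinity> else ereal (- log 2 p))"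

definition p_value :: "(bool list \<Rightarrow> real) \<Rightarrow> bool list \<Rightarrow> real" where
  "p_value \<tau> w = real (card {y. length y = length w \<and> \<tau> y \<ge> \<tau> w}) / 2 ^ length w"

text \<open>The dyadic interval of length \<open>2 ^ (- n)\<close> starting at \<open>0.x1...xn\<close> is identified with the
  cylinder of the word \<open>x1...xn\<close>.\<close>

definition lower_pointwise_dim :: "bool stream measure \<Rightarrow> bool stream \<Rightarrow> ereal" where
  "lower_pointwise_dim \<mu> x = liminf (\<lambda>n. neg_log2 (cyl \<mu> (stake n x)) / ereal (real n))"

text \<open>Total recursive functions, with minimisation restricted to regular functions. The first
  argument of \<open>recursive\<close> is the arity \<open>n\<close>; only values on lists of length \<open>n\<close> are meaningful.\<close>

inductive recursive :: "nat \<Rightarrow> (nat list \<Rightarrow> nat) \<Rightarrow> bool" where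
  zero: "recursive n (\<lambda>xs. 0)"
| succ: "recursive 1 (\<lambda>xs. Suc (xs ! 0))"
| proj: "i < n \<Longrightarrow> recursive n (\<lambda>xs. xs ! i)"
| comp: "\<lbrakk>recursive (length fs) g; \<forall>f \<in> set fs. recursive n f\<rbrakk>
    \<Longrightarrow> recursive n (\<lambda>xs. g (map (\<lambda>f. f xs) fs))"
| prim_rec: "\<lbrakk>recursive n f; recursive (n + 2) g\<rbrakk>
    \<Longrightarrow> recursive (Suc n) (\<lambda>xs. rec_nat (f (tl xs)) (\<lambda>k r. g (k # r # tl xs)) (hd xs))"
| minim: "\<lbrakk>recursive (Suc n) g; \<forall>xs. length xs = n \<longrightarrow> (\<exists>k. g (k # xs) = 0)\<rbrakk>
    \<Longrightarrow> recursive n (\<lambda>xs. LEAST k. g (k # xs) = 0)"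

definition word_code :: "bool list \<Rightarrow> nat" where
  "word_code w = list_encode (map of_bool w)"

text \<open>A rational is presented as \<open>(a - b) / c\<close> with naturals \<open>a\<close>, \<open>b\<close> and \<open>c > 0\<close>.\<close>

definition computable_rat_seq :: "(nat \<Rightarrow> bool list \<Rightarrow> rat) \<Rightarrow> bool" where
  "computable_rat_seq f \<longleftrightarrow>
    (\<exists>a b c. recursive 2 a \<and> recursive 2 b \<and> recursive 2 c \<and>
      (\<forall>k w. c [k, word_code w] > 0 \<and>
        f k w = (of_nat (a [k, word_code w]) - of_nat (b [k, word_code w]))
                / of_nat (c [k, word_code w])))"

text \<open>The values on cylinders are computable reals, uniformly in the word.\<close>

definition computable_measure :: "bool stream measure \<Rightarrow> bool" where
  "computable_measure \<mu> \<longleftrightarrow>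
    (\<exists>f. computable_rat_seq f \<and> (\<forall>k w. \<bar>real_of_rat (f k w) - cyl \<mu> w\<bar> \<le> 1 / 2 ^ k))"

definition semimeasure :: "(bool list \<Rightarrow> real) \<Rightarrow> bool" where
  "semimeasure M \<longleftrightarrow> (\<forall>u. 0 \<le> M u \<and> M u \<le> 1) \<and> M [] \<le> 1 \<and>
    (\<forall>u. M u \<ge> M (u @ [False]) + M (u @ [True]))"

definition enumerable :: "(bool list \<Rightarrow> real) \<Rightarrow> bool" where
  "enumerable M \<longleftrightarrow>
    (\<exists>f. computable_rat_seq f \<and> (\<forall>k w. f k w \<le> f (Suc k) w) \<and>
      (\<forall>w. (\<lambda>k. real_of_rat (f k w)) \<longlonglongrightarrow> M w))"

definition universal_semimeasure :: "(bool list \<Rightarrow> real) \<Rightarrow> bool" where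
  "universal_semimeasure M \<longleftrightarrow> semimeasure M \<and> enumerable M \<and>
    (\<forall>\<rho>. semimeasure \<rho> \<and> enumerable \<rho> \<longrightarrow> (\<exists>c>0. \<forall>u. M u \<ge> c * \<rho> u))"

end

theory Submission imports Defs
begin

text \<open>A semimeasure \<open>M\<close> has total mass at most 1 on the words of length \<open>n\<close>, so at most
  \<open>1 / M w\<close> of them satisfy \<open>M y \<ge> M w\<close> and \<open>- log \<pi>\<^sub>M(w) \<ge> n + log M(w)\<close>. If \<open>M\<close> dominates \<open>\<mu>\<close> up
  to a constant factor, dividing by \<open>n\<close> and passing to the limit superior gives the bound at every
  sequence \<open>x\<close>. The measure \<open>\<mu>\<close> dominates itself, and a universal \<open>M\<close> dominates a computable
  \<open>\<mu>\<close> because computable approximations \<open>f k\<close> with error \<open>2 ^ (- k)\<close> become nondecreasing after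
  subtracting \<open>3 * 2 ^ (- k)\<close>.\<close>

section \<open>Closure properties of recursive functions\<close>

lemma recursive_comp1:
  assumes "recursive 1 g" "recursive n f"
  shows "recursive n (\<lambda>xs. g [f xs])"
  using recursive.comp[of "[f]" g n] assms by simp

lemma recursive_comp2:
  assumes "recursive 2 g" "recursive n f" "recursive n h"
  shows "recursive n (\<lambda>xs. g [f xs, h xs])"
  using recursive.comp[of "[f, h]" g n] assms by (simp add: numeral_2_eq_2)

lemma recursive_Suc:
  assumes "recursive n f"
  shows "recursive n (\<lambda>xs. Suc (f xs))"
  using recursive_comp1[OF recursive.succ assms] by simp

lemma recursive_const: "recursive n (\<lambda>xs. c)"
  by (induction c) (auto intro: recursive.zero recursive_Suc)

lemma recursive_add:
  assumes "recursive n f" "recursive n g"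
  shows "recursive n (\<lambda>xs. f xs + g xs)"
proof -
  \<comment> \<open>In the step list \<open>k # r # tl xs\<close>, index 1 holds the running value
    \<open>r\<close>; index 2, used for products below, holds the second argument.\<close>
  have "recursive (Suc 1) (\<lambda>xs. rec_nat (tl xs ! 0) (\<lambda>k r. Suc ((k # r # tl xs) ! 1)) (hd xs))"
    by (intro recursive.prim_rec recursive_Suc recursive.proj) simp_all
  moreover have "rec_nat (tl xs ! 0) (\<lambda>k r. Suc ((k # r # tl xs) ! 1)) m = m + tl xs ! 0"
    for m and xs :: "nat list"
    by (induction m) simp_all
  ultimately have "recursive 2 (\<lambda>xs. hd xs + tl xs ! 0)"
    by (simp add: numeral_2_eq_2)
  from recursive_comp2[OF this assms] show ?thesis by simp
qed

lemma recursive_mult: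
  assumes "recursive n f" "recursive n g"
  shows "recursive n (\<lambda>xs. f xs * g xs)"
proof -
  have "recursive (Suc 1) (\<lambda>xs. rec_nat ((\<lambda>xs. 0) (tl xs))
      (\<lambda>k r. (k # r # tl xs) ! 1 + (k # r # tl xs) ! 2) (hd xs))"
    by (rule recursive.prim_rec, rule recursive.zero)
       (intro recursive_add recursive.proj; simp)
  moreover have "rec_nat 0 (\<lambda>k r. (k # r # tl xs) ! 1 + (k # r # tl xs) ! 2) m = m * tl xs ! 0"
    for m and xs :: "nat list"
    by (induction m) simp_all
  ultimately have "recursive 2 (\<lambda>xs. hd xs * tl xs ! 0)"
    by (simp add: numeral_2_eq_2)
  from recursive_comp2[OF this assms] show ?thesis by simp
qed

lemma recursive_power2:
  assumes "recursive n f"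
  shows "recursive n (\<lambda>xs. 2 ^ f xs)"
proof -
  have "recursive (Suc 0) (\<lambda>xs. rec_nat ((\<lambda>xs. 1) (tl xs))
      (\<lambda>k r. (k # r # tl xs) ! 1 + (k # r # tl xs) ! 1) (hd xs))"
    by (rule recursive.prim_rec, rule recursive_const)
       (intro recursive_add recursive.proj; simp)
  moreover have "rec_nat 1 (\<lambda>k r. (k # r # tl xs) ! 1 + (k # r # tl xs) ! 1) m = 2 ^ m"
    for m and xs :: "nat list"
    by (induction m) simp_all
  ultimately have "recursive 1 (\<lambda>xs. 2 ^ hd xs)"
    by simp
  from recursive_comp1[OF this assms] show ?thesis by simp
qed

section \<open>Computable approximations from below\<close>

lemma computable_rat_seq_diff_power2:
  assumes "computable_rat_seq f"
  shows "computable_rat_seq (\<lambda>k w. f k w - of_nat m / 2 ^ k)"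
proof -
  from assms obtain a b c where rec: "recursive 2 a" "recursive 2 b" "recursive 2 c"
    and c: "\<And>k w. c [k, word_code w] > 0"
    and f: "\<And>k w. f k w = (of_nat (a [k, word_code w]) - of_nat (b [k, word_code w]))
                / of_nat (c [k, word_code w])"
    unfolding computable_rat_seq_def by blast
  define p where "p = (\<lambda>xs :: nat list. (2 :: nat) ^ (xs ! 0))"
  have p: "recursive 2 p"
    unfolding p_def by (intro recursive_power2 recursive.proj) simp
  \<comment> \<open>Over the common denominator \<open>c * 2 ^ k\<close>, the subtracted term joins
    the negative part \<open>b'\<close>, so no subtraction of naturals is needed.\<close>
  define a' where "a' = (\<lambda>xs. a xs * p xs)"
  define b' where "b' = (\<lambda>xs. b xs * p xs + m * c xs)"
  define c' where "c' = (\<lambda>xs. c xs * p xs)"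
  have "recursive 2 a'" "recursive 2 b'" "recursive 2 c'"
    unfolding a'_def b'_def c'_def
    by (intro recursive_add recursive_mult recursive_const rec p)+
  moreover have "c' [k, word_code w] > 0 \<and>
      f k w - of_nat m / 2 ^ k = (of_nat (a' [k, word_code w]) - of_nat (b' [k, word_code w]))
                / of_nat (c' [k, word_code w])" for k w
    using c[of k w] by (simp add: f a'_def b'_def c'_def p_def field_simps)
  ultimately show ?thesis
    unfolding computable_rat_seq_def by blast
qed

lemma enumerable_if_computable_measure:
  assumes "computable_measure \<mu>"
  shows "enumerable (cyl \<mu>)"
proof -
  from assms obtain f where f: "computable_rat_seq f"
    and approx: "\<And>k w. \<bar>real_of_rat (f k w) - cyl \<mu> w\<bar> \<le> 1 / 2 ^ k"
    unfolding computable_measure_def by blast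
  \<comment> \<open>With \<open>d = 1 / 2 ^ k\<close>, consecutive \<open>f k w\<close> differ by at
    most \<open>d + d / 2\<close>. This equals the decrease of the shift from \<open>3 * d\<close>
    to \<open>3 * d / 2\<close>, which is where 3 comes from.\<close>
  define g where "g = (\<lambda>k w. f k w - of_nat 3 / 2 ^ k)"
  have g_real: "real_of_rat (g k w) = real_of_rat (f k w) - 3 / 2 ^ k" for k w
    by (simp add: g_def of_rat_diff of_rat_divide of_rat_power)
  have "g k w \<le> g (Suc k) w" for k w
  proof -
    define d :: real where "d = 1 / 2 ^ k"
    have "\<bar>real_of_rat (f k w) - cyl \<mu> w\<bar> \<le> d" "\<bar>real_of_rat (f (Suc k) w) - cyl \<mu> w\<bar> \<le> d / 2"
      using approx[of k w] approx[of "Suc k" w] by (simp_all add: d_def)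
    moreover have "real_of_rat (g k w) = real_of_rat (f k w) - 3 * d"
      and "real_of_rat (g (Suc k) w) = real_of_rat (f (Suc k) w) - 3 * (d / 2)"
      by (simp_all add: g_real d_def)
    ultimately have "real_of_rat (g k w) \<le> real_of_rat (g (Suc k) w)"
      by linarith
    then show ?thesis by (simp add: of_rat_less_eq)
  qed
  moreover have "(\<lambda>k. real_of_rat (g k w)) \<longlonglongrightarrow> cyl \<mu> w" for w
  proof -
    have lim0: "(\<lambda>k. c / 2 ^ k) \<longlonglongrightarrow> 0" for c :: real
      using LIMSEQ_divide_realpow_zero[of 2 c] by simp
    have "(\<lambda>k. real_of_rat (f k w) - cyl \<mu> w) \<longlonglongrightarrow> 0"
      using approx by (intro Lim_null_comparison[OF _ lim0[of 1]]) simp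
    then have "(\<lambda>k. (real_of_rat (f k w) - cyl \<mu> w) - 3 / 2 ^ k + cyl \<mu> w)
        \<longlonglongrightarrow> 0 - 0 + cyl \<mu> w"
      by (intro tendsto_intros lim0)
    then show ?thesis by (simp add: g_real algebra_simps)
  qed
  moreover have "computable_rat_seq g"
    unfolding g_def by (rule computable_rat_seq_diff_power2[OF f])
  ultimately show ?thesis
    unfolding enumerable_def by blast
qed

section \<open>Semimeasures and cylinder measures\<close>

lemma finite_words: "finite {y :: bool list. length y = n}"
  using finite_lists_length_eq[of "UNIV :: bool set" n] by simp

lemma semimeasure_sum_le_1:
  assumes "semimeasure M"
  shows "(\<Sum>y | length y = n. M y) \<le> 1"
proof (induction n)
  case 0
  then show ?case using assms by (simp add: semimeasure_def)
next
  case (Suc n)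
  \<comment> \<open>Words are split at their last letter, since the semimeasure inequality bounds
    the two one-letter extensions of \<open>u\<close> by \<open>u\<close> itself.\<close>
  have eq: "{y :: bool list. length y = Suc n} = (\<lambda>(u, b). u @ [b]) ` ({u. length u = n} \<times> UNIV)"
    by (auto simp: image_iff length_Suc_conv_rev)
  have "(\<Sum>y | length y = Suc n. M y) = (\<Sum>(u, b) \<in> {u. length u = n} \<times> UNIV. M (u @ [b]))"
    unfolding eq by (subst sum.reindex) (auto simp: inj_on_def case_prod_unfold)
  also have "\<dots> = (\<Sum>u | length u = n. M (u @ [False]) + M (u @ [True]))"
    by (simp add: sum.cartesian_product[symmetric] UNIV_bool)
  also have "\<dots> \<le> (\<Sum>u | length u = n. M u)"
    using assms by (intro sum_mono) (simp add: semimeasure_def)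
  finally show ?case using Suc by simp
qed

text \<open>The cylinder of \<open>u\<close> is the disjoint union of the cylinders of its two
  extensions, so the inequality even holds with equality.\<close>

lemma semimeasure_cyl:
  assumes "prob_space \<mu>" and sets: "sets \<mu> = sets (stream_space (count_space UNIV))"
  shows "semimeasure (cyl \<mu>)"
proof -
  interpret prob_space \<mu> by fact
  have space: "space \<mu> = UNIV"
    using sets_eq_imp_space_eq[OF sets] by (simp add: space_stream_space)
  have meas: "{x \<in> space \<mu>. stake (length w) x = w} \<in> sets \<mu>" for w :: "bool list"
  proof -
    from measurable_sets[OF measurable_stake, of "{w}" "length w"] show ?thesis
      by (simp add: sets space space_stream_space vimage_def)
  qed
  have "cyl \<mu> (u @ [False]) + cyl \<mu> (u @ [True]) = cyl \<mu> u" for u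
  proof -
    let ?C = "\<lambda>w. {x \<in> space \<mu>. stake (length w) x = w}"
    have split: "?C u = ?C (u @ [False]) \<union> ?C (u @ [True])"
      \<comment> \<open>\<open>stake_Suc\<close> exposes the last letter, which decides between the
        two halves.\<close>
      unfolding length_append_singleton stake_Suc by auto
    have "?C (u @ [False]) \<inter> ?C (u @ [True]) = {}"
      by auto
    from finite_measure_Union[OF meas meas this] show ?thesis
      unfolding cyl_def split by (rule sym)
  qed
  moreover have "0 \<le> cyl \<mu> u" "cyl \<mu> u \<le> 1" for u
    by (simp_all add: cyl_def)
  ultimately show ?thesis
    by (simp add: semimeasure_def)
qed

section \<open>Bounds on p-values\<close>

lemma p_value_pos: "p_value \<tau> w > 0"
proof -
  have "finite {y. length y = length w \<and> \<tau> y \<ge> \<tau> w}"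
    by (rule finite_subset[OF _ finite_words[of "length w"]]) auto
  \<comment> \<open>The word \<open>w\<close> itself is counted.\<close>
  then have "card {y. length y = length w \<and> \<tau> y \<ge> \<tau> w} > 0"
    by (subst card_gt_0_iff) auto
  then show ?thesis by (simp add: p_value_def)
qed

text \<open>Markov's inequality for the uniform distribution on words: every counted word has mass
  at least \<open>M w\<close>, and the total mass is at most 1.\<close>

lemma p_value_semimeasure_le:
  assumes M: "semimeasure M" and pos: "M w > 0"
  shows "p_value M w \<le> 1 / (2 ^ length w * M w)"
proof -
  let ?A = "{y. length y = length w \<and> M y \<ge> M w}"
  have "card ?A * M w = (\<Sum>y \<in> ?A. M w)" by simp
  also have "\<dots> \<le> (\<Sum>y \<in> ?A. M y)" by (intro sum_mono) simp
  also have "\<dots> \<le> (\<Sum>y | length y = length w. M y)"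
    using M by (intro sum_mono2[OF finite_words]) (auto simp: semimeasure_def)
  also have "\<dots> \<le> 1" by (rule semimeasure_sum_le_1[OF M])
  finally have "card ?A * M w \<le> 1" .
  then show ?thesis using pos by (simp add: p_value_def field_simps)
qed

lemma neg_log2_p_value_ge:
  assumes M: "semimeasure M" and "c > 0" and "M w \<ge> c * p" and "p > 0"
  shows "neg_log2 (p_value M w) \<ge> ereal (real (length w) + log 2 c + log 2 p)"
proof -
  have pos: "M w > 0" using assms by (meson mult_pos_pos less_le_trans)
  have "log 2 (p_value M w) \<le> log 2 (1 / (2 ^ length w * M w))"
    using p_value_semimeasure_le[OF M pos] p_value_pos[of M w] by (intro log_mono) simp_all
  also have "\<dots> = - real (length w) - log 2 (M w)"
    using pos by (simp add: log_divide log_mult log_nat_power)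
  finally have "log 2 (p_value M w) \<le> - real (length w) - log 2 (M w)" .
  moreover have "log 2 (c * p) \<le> log 2 (M w)"
    using assms pos by simp
  ultimately show ?thesis
    using assms p_value_pos[of M w] by (simp add: neg_log2_def log_mult)
qed

text \<open>Domination costs only the additive constant \<open>log 2 c\<close>, which vanishes after
  division by \<open>n\<close>. The bound holds for every \<open>x\<close> and serves both parts of
  the theorem.\<close>

lemma limsup_p_value_ge:
  assumes M: "semimeasure M" and c: "c > 0" and dom: "\<And>u. M u \<ge> c * cyl \<mu> u"
  shows "limsup (\<lambda>n. neg_log2 (p_value M (stake n x)) / ereal (real n))
    \<ge> 1 - lower_pointwise_dim \<mu> x"
proof -
  let ?a = "\<lambda>n. neg_log2 (p_value M (stake n x)) / ereal (real n)"
  let ?b = "\<lambda>n. neg_log2 (cyl \<mu> (stake n x)) / ereal (real n)"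
  have "(\<lambda>n. ereal (1 + log 2 c / real n)) \<longlonglongrightarrow> ereal (1 + 0)"
    by (intro tendsto_intros lim_const_over_n)
  \<comment> \<open>A sequence with a finite limit can be pulled out of the limit superior even
    though \<open>- ?b n\<close> may be infinite; negation then turns the limit inferior in the
    dimension into a limit superior.\<close>
  then have "limsup (\<lambda>n. ereal (1 + log 2 c / real n) + - ?b n) = 1 + limsup (\<lambda>n. - ?b n)"
    by (subst ereal_limsup_lim_add[of _ 1]) (simp_all add: one_ereal_def)
  also have "\<dots> = 1 - lower_pointwise_dim \<mu> x"
    by (simp add: lower_pointwise_dim_def ereal_Limsup_uminus minus_ereal_def)
  finally have "1 - lower_pointwise_dim \<mu> x = limsup (\<lambda>n. ereal (1 + log 2 c / real n) + - ?b n)"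
    by simp
  also have "\<dots> \<le> limsup ?a"
  proof (rule Limsup_mono, rule eventually_sequentiallyI[of 1])
    fix n :: nat assume n: "1 \<le> n"
    let ?p = "cyl \<mu> (stake n x)"
    show "ereal (1 + log 2 c / real n) + - ?b n \<le> ?a n"
    proof (cases "?p = 0")
      \<comment> \<open>Here \<open>?b n\<close> is infinite, so the left-hand side is
        \<open>-\<infinity>\<close>; this uses \<open>n \<ge> 1\<close>.\<close>
      case True
      then show ?thesis using n by (simp add: neg_log2_def)
    next
      case False
      then have p: "?p > 0" by (simp add: cyl_def zero_less_measure_iff)
      have "(real n + log 2 c + log 2 ?p) / real n \<le> - log 2 (p_value M (stake n x)) / real n"
        using neg_log2_p_value_ge[OF M c dom p] p_value_pos[of M "stake n x"]
        by (intro divide_right_mono) (simp_all add: neg_log2_def)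
      then show ?thesis
        using n False p_value_pos[of M "stake n x"]
        by (simp add: neg_log2_def add_divide_distrib)
    qed
  qed
  finally show ?thesis .
qed

theorem theorem1:
  fixes \<mu> :: "bool stream measure"
  assumes "prob_space \<mu>"
    and "sets \<mu> = sets (stream_space (count_space UNIV))"
    and "\<mu> \<noteq> fair_coin"
  shows "(AE x in \<mu>. limsup (\<lambda>n. neg_log2 (p_value (cyl \<mu>) (stake n x)) / ereal (real n))
            \<ge> 1 - lower_pointwise_dim \<mu> x) \<and>
         (\<forall>M. universal_semimeasure M \<longrightarrow> computable_measure \<mu> \<longrightarrow>
            (AE x in \<mu>. limsup (\<lambda>n. neg_log2 (p_value M (stake n x)) / ereal (real n))
              \<ge> 1 - lower_pointwise_dim \<mu> x))"
proof (intro conjI allI impI)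
  have \<mu>: "semimeasure (cyl \<mu>)"
    using assms(1,2) by (rule semimeasure_cyl)
  show "AE x in \<mu>. limsup (\<lambda>n. neg_log2 (p_value (cyl \<mu>) (stake n x)) / ereal (real n))
      \<ge> 1 - lower_pointwise_dim \<mu> x"
    \<comment> \<open>The measure dominates itself with constant 1.\<close>
    using limsup_p_value_ge[OF \<mu>, of 1] by simp
  fix M assume M: "universal_semimeasure M" and "computable_measure \<mu>"
  then have "enumerable (cyl \<mu>)"
    by (intro enumerable_if_computable_measure)
  \<comment> \<open>Universality is applied to the semimeasure \<open>cyl \<mu>\<close>.\<close>
  with M \<mu> obtain c where "c > 0" "\<And>u. M u \<ge> c * cyl \<mu> u" and "semimeasure M"
    unfolding universal_semimeasure_def by blast
  then show "AE x in \<mu>. limsup (\<lambda>n. neg_log2 (p_value M (stake n x)) / ereal (real n))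
      \<ge> 1 - lower_pointwise_dim \<mu> x"
    using limsup_p_value_ge[of M c] by simp
qed

end
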